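(* Let $P$ be a random interval order on $n$ elements and let $0<\epsilon<1$ be fixed. Then with high probability $$\bigl(1-\epsilon+o(1)\bigr)n\log_2 n\le \log_2 e(P)\le \bigl(1+\epsilon+o(1)\bigr)n\log_2 n.$$
   Context: A random interval order is generated by drawing $2n$ independent uniform random numbers $X_1,\dots,X_n,Y_1,\dots,Y_n$ in $[0,1]$, forming the closed intervals $I_j$ with endpoints $X_j$ and $Y_j$, and declaring $I_i\prec I_j$ iff the maximum of $I_i$ is less than the minimum of $I_j$. $e(P)$ is the number of linear extensions of $P$. "With high probability" means with probability tending to $1$ as $n\to\infty$. *)

theory Defs
  imports "HOL-Probability.Probability" "HOL-Library.Landau_Symbols"
begin

text \<open>A sample point \<open>\<omega>\<close> assigns to each index \<open>j < n\<close> the pair \<open>(X\<^sub>j, Y\<^sub>j)\<close>; under the product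
  measure all \<open>2n\<close> coordinates are independent and uniform on \<open>[0,1]\<close>.\<close>

definition random_endpoints :: "nat \<Rightarrow> (nat \<Rightarrow> real \<times> real) measure" where
  "random_endpoints n =
     (\<Pi>\<^sub>M j\<in>{..<n}. uniform_measure lborel {0..1} \<Otimes>\<^sub>M uniform_measure lborel {0..1})"

definition interval_of :: "real \<times> real \<Rightarrow> real set" where
  "interval_of p = {min (fst p) (snd p)..max (fst p) (snd p)}"

text \<open>The intervals are compact and nonempty, so \<open>Sup\<close> and \<open>Inf\<close> are their maximum and minimum.\<close>

definition interval_order :: "nat \<Rightarrow> (nat \<Rightarrow> real \<times> real) \<Rightarrow> nat rel" where
  "interval_order n \<omega> =
     {(i, j). i < n \<and> j < n \<and> Sup (interval_of (\<omega> i)) < Inf (interval_of (\<omega> j))}"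

text \<open>Orders are represented by their strict parts. The condition \<open>L \<subseteq> A \<times> A\<close> is needed because
  \<^const>\<open>strict_linear_order_on\<close> does not confine the relation to \<open>A\<close>.\<close>

definition linear_extensions :: "'a set \<Rightarrow> 'a rel \<Rightarrow> 'a rel set" where
  "linear_extensions A r = {L. L \<subseteq> A \<times> A \<and> strict_linear_order_on A L \<and> r \<subseteq> L}"

definition num_linear_extensions :: "'a set \<Rightarrow> 'a rel \<Rightarrow> nat" where
  "num_linear_extensions A r = card (linear_extensions A r)"

end

theory Submission
  imports Defs "HOL-Combinatorics.Permutations" "HOL-Real_Asymp.Real_Asymp"
begin

text \<open>The upper bound \<open>e(P) \<le> n\<^sup>n\<close> holds for every order. For the lower bound, choose a point in each
  interval; sorting the intervals by their points and breaking ties by an arbitrary permutation gives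
  a linear extension. Intervals of length at least \<open>1 / m\<close> can share \<open>m + 1\<close> grid points, which gives
  \<open>n! \<le> e(P) (m + 1)\<^sup>n n\<^sup>b\<close> where \<open>b\<close> is the number of shorter intervals. With \<open>m\<close> of order \<open>ln n\<close>,
  Markov's inequality shows \<open>b \<le> (\<epsilon> / 2) n\<close> with high probability. Both \<open>o(1)\<close> terms can be
  taken to be \<open>0\<close>.\<close>

section \<open>Counting linear extensions of a finite order\<close>

text \<open>An element of a finite linear order is determined by its rank. The rank of
  \<open>f x\<close> in the common image is the number of \<open>y\<close> in \<open>C\<close> with
  \<open>f y < f x\<close>, and \<open>ord\<close> makes this number the same for
  \<open>g\<close>.\<close>

lemma inj_on_eq_if_same_order:
  fixes f g :: "'a \<Rightarrow> 'b::linorder"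
  assumes "finite C" and f: "inj_on f C" and g: "inj_on g C" and img: "f ` C = g ` C"
    and ord: "\<And>x y. x \<in> C \<Longrightarrow> y \<in> C \<Longrightarrow> f x < f y \<longleftrightarrow> g x < g y" and x: "x \<in> C"
  shows "f x = g x"
proof -
  have rank: "card {z \<in> h ` C. z < h x} = card {y \<in> C. h y < h x}" if "inj_on h C" for h :: "'a \<Rightarrow> 'b"
  proof -
    have "{z \<in> h ` C. z < h x} = h ` {y \<in> C. h y < h x}" by auto
    then show ?thesis using card_image inj_on_subset[OF that] by (metis (no_types, lifting) mem_Collect_eq subsetI)
  qed
  have "{y \<in> C. f y < f x} = {y \<in> C. g y < g x}" using ord x by auto
  then have eq: "card {z \<in> f ` C. z < f x} = card {z \<in> f ` C. z < g x}"
    using rank[OF f] rank[OF g] img by simp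
  have less: "card {z \<in> f ` C. z < a} < card {z \<in> f ` C. z < b}" if "a < b" "a \<in> f ` C" for a b
    using that \<open>finite C\<close> by (intro psubset_card_mono) auto
  have "f x \<in> f ` C" using x by (rule imageI)
  moreover have "g x \<in> f ` C" unfolding img using x by (rule imageI)
  ultimately show ?thesis
    using less[of "f x" "g x"] less[of "g x" "f x"] eq by (cases "f x" "g x" rule: linorder_cases) simp_all
qed

lemma finite_linear_extensions: "finite A \<Longrightarrow> finite (linear_extensions A r)"
  by (rule finite_subset[of _ "Pow (A \<times> A)"]) (auto simp: linear_extensions_def)

text \<open>A linear extension is determined by the function counting the predecessors of each
  element, so there are at most as many as functions from \<open>A\<close> to
  \<open>{..<card A}\<close>.\<close>

lemma num_linear_extensions_le:
  assumes "finite A"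
  shows "num_linear_extensions A r \<le> card A ^ card A"
proof -
  define rk where "rk L = (\<lambda>x\<in>A. card {y \<in> A. (y, x) \<in> L})" for L
  have rk_less: "rk L x < rk L y \<longleftrightarrow> (x, y) \<in> L" if L: "L \<in> linear_extensions A r" and xy: "x \<in> A" "y \<in> A" for L x y
  proof -
    have lin: "trans L" "irrefl L" "total_on A L" using L by (auto simp: linear_extensions_def strict_linear_order_on_def)
    have imp: "rk L x < rk L y" if "(x, y) \<in> L" "x \<in> A" "y \<in> A" for x y
    proof -
      have "{z \<in> A. (z, x) \<in> L} \<subset> {z \<in> A. (z, y) \<in> L}"
        using that lin by (auto simp: irrefl_def dest: transD)
      then show ?thesis using that assms by (auto simp: rk_def intro!: psubset_card_mono)
    qed
    show ?thesis using imp[of x y] imp[of y x] lin(3) xy unfolding total_on_def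
      by (metis order_less_asym order_less_irrefl)
  qed
  have "inj_on rk (linear_extensions A r)"
  proof (rule inj_onI)
    fix L L' assume H: "L \<in> linear_extensions A r" "L' \<in> linear_extensions A r" "rk L = rk L'"
    then have "L \<subseteq> A \<times> A" "L' \<subseteq> A \<times> A" by (auto simp: linear_extensions_def)
    with H rk_less show "L = L'" by (metis (no_types, lifting) mem_Sigma_iff subset_eq subrelI subset_antisym)
  qed
  moreover have "rk ` linear_extensions A r \<subseteq> A \<rightarrow>\<^sub>E {..<card A}"
  proof (intro image_subsetI PiE_I)
    fix L x assume L: "L \<in> linear_extensions A r" and x: "x \<in> A"
    \<comment> \<open>By irreflexivity \<open>x\<close> is not among its own predecessors, so its
      rank stays below \<open>card A\<close>.\<close>
    then have "{y \<in> A. (y, x) \<in> L} \<subset> A"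
      by (auto simp: linear_extensions_def strict_linear_order_on_def irrefl_def)
    then show "rk L x \<in> {..<card A}" using x assms by (auto simp: rk_def intro!: psubset_card_mono)
  qed (auto simp: rk_def)
  ultimately have "card (linear_extensions A r) \<le> card (A \<rightarrow>\<^sub>E {..<card A})"
    by (rule card_inj_on_le) (use assms in \<open>auto intro: finite_PiE\<close>)
  then show ?thesis using assms by (simp add: num_linear_extensions_def card_PiE)
qed

definition lex_order :: "'a set \<Rightarrow> ('a \<Rightarrow> 'b::linorder) \<Rightarrow> ('a \<Rightarrow> 'c::linorder) \<Rightarrow> 'a rel" where
  "lex_order A p q = {(x, y) \<in> A \<times> A. p x < p y \<or> p x = p y \<and> q x < q y}"

lemma lex_order_linear_extension:
  assumes "inj_on q A" and "\<And>x y. (x, y) \<in> r \<Longrightarrow> x \<in> A \<and> y \<in> A \<and> p x < p y"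
  shows "lex_order A p q \<in> linear_extensions A r"
proof -
  have "trans (lex_order A p q)" by (auto simp: lex_order_def intro!: transI)
  moreover have "irrefl (lex_order A p q)" by (auto simp: lex_order_def irrefl_def)
  moreover have "total_on A (lex_order A p q)"
    using assms(1) by (auto simp: lex_order_def total_on_def inj_on_def) (meson linorder_neqE)
  ultimately show ?thesis using assms(2)
    by (auto simp: linear_extensions_def strict_linear_order_on_def lex_order_def)
qed

text \<open>A permutation \<open>\<pi>\<close> can be recovered from the linear extension that sorts by \<open>p\<close> and breaks ties
  by \<open>\<pi>\<close>, together with the values of \<open>\<pi>\<close> on \<open>B\<close> and the colours of the elements listed in the
  order given by \<open>\<pi>\<close>: off \<open>B\<close>, the elements of one colour have a common value of \<open>p\<close>, so the
  set of their positions and their relative order are known.\<close>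

lemma fact_le_num_linear_extensions:
  fixes A :: "'a::linorder set" and p :: "'a \<Rightarrow> 'b::linorder"
  assumes fin: "finite A" "finite M" and B: "B \<subseteq> A" and c: "c \<in> A \<rightarrow> M"
    and p: "\<And>x y. (x, y) \<in> r \<Longrightarrow> x \<in> A \<and> y \<in> A \<and> p x < p y"
    and cp: "\<And>x y. x \<in> A - B \<Longrightarrow> y \<in> A - B \<Longrightarrow> c x = c y \<Longrightarrow> p x = p y"
  shows "fact (card A) \<le> num_linear_extensions A r * card M ^ card A * card A ^ card B"
proof -
  define code where "code \<pi> = (lex_order A p \<pi>, (\<lambda>k\<in>A. c (inv \<pi> k)), (\<lambda>x\<in>B. \<pi> x))" for \<pi> :: "'a \<Rightarrow> 'a"
  let ?P = "{\<pi>. \<pi> permutes A}"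
  let ?T = "linear_extensions A r \<times> (A \<rightarrow>\<^sub>E M) \<times> (B \<rightarrow>\<^sub>E A)"
  have "inj_on code ?P"
  proof (rule inj_onI)
    fix f g assume "f \<in> ?P" "g \<in> ?P" and eq: "code f = code g"
    then have f: "f permutes A" and g: "g permutes A" by auto
    have L: "lex_order A p f = lex_order A p g" using eq by (simp add: code_def)
    have "(\<lambda>k\<in>A. c (inv f k)) = (\<lambda>k\<in>A. c (inv g k))" "(\<lambda>x\<in>B. f x) = (\<lambda>x\<in>B. g x)"
      using eq by (simp_all add: code_def)
    then have col: "c (inv f k) = c (inv g k)" if "k \<in> A" for k
      using that by (metis restrict_apply')
    have onB: "f x = g x" if "x \<in> B" for x
      using \<open>(\<lambda>x\<in>B. f x) = (\<lambda>x\<in>B. g x)\<close> that by (metis restrict_apply')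
    have "f x = g x" if x: "x \<in> A - B" for x
    proof -
      let ?C = "{y \<in> A - B. c y = c x}"
      \<comment> \<open>Elements of \<open>B\<close> carry colours too, so their positions are
        removed. The right-hand side depends only on the second and third components of
        \<open>code h\<close>.\<close>
      have img: "h ` ?C = {k \<in> A. c (inv h k) = c x} - h ` B" if h: "h permutes A" for h
      proof
        show "h ` ?C \<subseteq> {k \<in> A. c (inv h k) = c x} - h ` B"
          using h permutes_inj[OF h] by (auto simp: permutes_inverses permutes_in_image inj_eq)
        show "{k \<in> A. c (inv h k) = c x} - h ` B \<subseteq> h ` ?C"
        proof
          fix k assume k: "k \<in> {k \<in> A. c (inv h k) = c x} - h ` B"
          have hk: "h (inv h k) = k" by (rule permutes_inverses(1)[OF h])
          have "inv h k \<notin> B"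
          proof
            assume "inv h k \<in> B"
            then have "h (inv h k) \<in> h ` B" by (rule imageI)
            then show False using k hk by simp
          qed
          moreover have "inv h k \<in> A"
            using k permutes_in_image[OF permutes_inv[OF h]] by simp
          ultimately have "h (inv h k) \<in> h ` ?C" using k by (intro imageI) simp
          then show "k \<in> h ` ?C" by (simp only: hk)
        qed
      qed
      have "{k \<in> A. c (inv f k) = c x} = {k \<in> A. c (inv g k) = c x}"
        using col by auto
      moreover have "f ` B = g ` B" using onB by (rule image_cong[OF refl])
      ultimately have "f ` ?C = g ` ?C" by (simp only: img[OF f] img[OF g])
      moreover have "f y < f z \<longleftrightarrow> g y < g z" if "y \<in> ?C" "z \<in> ?C" for y z
      proof -
        \<comment> \<open>Within one colour class every comparison is a tie for \<open>p\<close>, so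
          the first component of the code reveals the order of the values of the
          permutation.\<close>
        have "p y = p z" using cp that by auto
        moreover have "y \<in> A" "z \<in> A" using that by auto
        ultimately have "h y < h z \<longleftrightarrow> (y, z) \<in> lex_order A p h" for h :: "'a \<Rightarrow> 'a"
          by (auto simp: lex_order_def)
        then show ?thesis using L by simp
      qed
      ultimately show ?thesis
        using x fin permutes_inj_on[OF f] permutes_inj_on[OF g]
        by (intro inj_on_eq_if_same_order[of ?C f g x]) auto
    qed
    then show "f = g" using onB f g by (intro ext) (metis DiffI permutes_not_in)
  qed
  moreover have "code ` ?P \<subseteq> ?T"
  proof (rule image_subsetI)
    fix \<pi> assume "\<pi> \<in> ?P"
    then have \<pi>: "\<pi> permutes A" by simp
    have "lex_order A p \<pi> \<in> linear_extensions A r"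
      using permutes_inj_on[OF \<pi>] p by (rule lex_order_linear_extension)
    moreover have "(\<lambda>k\<in>A. c (inv \<pi> k)) \<in> A \<rightarrow>\<^sub>E M"
      using c permutes_in_image[OF permutes_inv[OF \<pi>]] by auto
    moreover have "(\<lambda>x\<in>B. \<pi> x) \<in> B \<rightarrow>\<^sub>E A"
      using B permutes_in_image[OF \<pi>] by auto
    ultimately show "code \<pi> \<in> ?T" by (simp add: code_def)
  qed
  moreover have "finite ?T"
    using fin B finite_linear_extensions by (auto intro!: finite_PiE dest: finite_subset)
  ultimately have "card ?P \<le> card ?T" by (rule card_inj_on_le)
  moreover have "card ?P = fact (card A)"
    using fin by (intro card_permutations) auto
  moreover have "finite B" using fin B by (simp add: finite_subset)
  ultimately show ?thesis
    using fin by (simp add: num_linear_extensions_def card_cartesian_product card_PiE mult.assoc)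
qed

section \<open>Grid points in the intervals\<close>

lemma Sup_interval_of: "Sup (interval_of p) = max (fst p) (snd p)"
  and Inf_interval_of: "Inf (interval_of p) = min (fst p) (snd p)"
  by (auto simp: interval_of_def)

text \<open>The pairs outside the unit square, which have probability \<open>0\<close>, are counted as short.\<close>

definition short_pairs :: "real \<Rightarrow> (real \<times> real) set" where
  "short_pairs d = {p. \<not> (0 \<le> min (fst p) (snd p) \<and> max (fst p) (snd p) \<le> 1 \<and> d \<le> \<bar>fst p - snd p\<bar>)}"

text \<open>Every interval of length at least \<open>1 / m\<close> contains a point of the grid \<open>{0, 1/m, \<dots>, 1}\<close>, so
  each such interval can be represented by one of \<open>m + 1\<close> points.\<close>

lemma fact_le_num_linear_extensions_interval_order:
  assumes m: "m > 0"
  shows "fact n \<le> num_linear_extensions {..<n} (interval_order n \<omega>) * (m + 1) ^ n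
           * n ^ card {j \<in> {..<n}. \<omega> j \<in> short_pairs (1 / real m)}"
proof -
  define B where "B = {j \<in> {..<n}. \<omega> j \<in> short_pairs (1 / real m)}"
  define a where "a j = min (fst (\<omega> j)) (snd (\<omega> j))" for j
  define b where "b j = max (fst (\<omega> j)) (snd (\<omega> j))" for j
  \<comment> \<open>A long interval is represented by the first grid point not below its left
    endpoint, a short one by the left endpoint itself. The colour \<open>c j\<close> is the grid
    index; on \<open>B\<close> it is the dummy value 0.\<close>
  define p where "p j = (if j \<in> B then a j else real_of_int \<lceil>a j * m\<rceil> / m)" for j
  define c where "c j = (if j \<in> B then 0 else nat \<lceil>a j * m\<rceil>)" for j
  have good: "0 \<le> a j" "b j \<le> 1" "a j + 1 / m \<le> b j" if "j \<in> {..<n} - B" for j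
    using that by (auto simp: B_def a_def b_def short_pairs_def min_def max_def abs_if split: if_splits)
  have pin: "a j \<le> p j \<and> p j \<le> b j" if "j < n" for j
  proof (cases "j \<in> B")
    case True then show ?thesis by (auto simp: p_def a_def b_def)
  next
    case False
    have "a j * m \<le> real_of_int \<lceil>a j * m\<rceil>" by simp
    then have "a j \<le> p j" using False m by (simp add: p_def field_simps)
    moreover have "real_of_int \<lceil>a j * m\<rceil> \<le> a j * m + 1" by linarith
    then have "p j \<le> a j + 1 / m" using False m by (simp add: p_def field_simps)
    ultimately show ?thesis using good[of j] False that by auto
  qed
  have "fact (card {..<n}) \<le> num_linear_extensions {..<n} (interval_order n \<omega>) * card {..m} ^ card {..<n}
           * card {..<n} ^ card B"
  proof (rule fact_le_num_linear_extensions)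
    show "B \<subseteq> {..<n}" by (auto simp: B_def)
    show "c \<in> {..<n} \<rightarrow> {..m}"
    proof
      fix j assume j: "j \<in> {..<n}"
      show "c j \<in> {..m}"
      proof (cases "j \<in> B")
        case True then show ?thesis by (simp add: c_def)
      next
        case False
        have "a j \<le> 1" using good[of j] j False by (auto simp: a_def b_def)
        then have "a j * m \<le> m" using m by simp
        then have "\<lceil>a j * m\<rceil> \<le> int m" by (simp add: ceiling_le_iff)
        then show ?thesis using False by (simp add: c_def nat_le_iff del: ceiling_le_iff)
      qed
    qed
    show "x \<in> {..<n} \<and> y \<in> {..<n} \<and> p x < p y" if "(x, y) \<in> interval_order n \<omega>" for x y
      using that pin[of x] pin[of y]
      by (auto simp: interval_order_def Sup_interval_of Inf_interval_of a_def b_def)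
    show "p x = p y" if "x \<in> {..<n} - B" "y \<in> {..<n} - B" "c x = c y" for x y
    proof -
      \<comment> \<open>Equal colours give equal ceilings only because \<open>nat\<close> is
        injective on nonnegative integers.\<close>
      have "0 \<le> a x * m" "0 \<le> a y * m" using good(1) that by simp_all
      then have "0 \<le> \<lceil>a x * m\<rceil>" "0 \<le> \<lceil>a y * m\<rceil>" by linarith+
      then have "\<lceil>a x * m\<rceil> = \<lceil>a y * m\<rceil>" using that by (simp add: c_def eq_nat_nat_iff del: zero_le_ceiling)
      then show ?thesis using that by (simp add: p_def)
    qed
  qed auto
  then show ?thesis by (simp add: B_def)
qed

section \<open>Bounds in logarithmic form\<close>

lemma log_num_linear_extensions_le:
  assumes "n > 0"
  shows "log 2 (num_linear_extensions {..<n} r) \<le> real n * log 2 n"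
proof (cases "num_linear_extensions {..<n} r = 0")
  \<comment> \<open>For arbitrary \<open>r\<close> there may be no linear extension; the convention
    \<open>ln 0 = 0\<close> then makes the left side 0.\<close>
  case True
  then show ?thesis using assms by (simp add: log_def)
next
  case False
  have "real (num_linear_extensions {..<n} r) \<le> real n ^ n"
    using num_linear_extensions_le[of "{..<n}" r] by (metis card_lessThan finite_lessThan of_nat_le_iff of_nat_power)
  then have "log 2 (num_linear_extensions {..<n} r) \<le> log 2 (real n ^ n)"
    using False by (subst log_le_cancel_iff) auto
  then show ?thesis using assms by (simp add: log_nat_power)
qed

text \<open>The quotient of \<open>n ^ n\<close> by \<open>fact n\<close> is a single term of the
  exponential series at \<open>n\<close>.\<close>

lemma power_le_exp_fact: "real n ^ n \<le> exp (real n) * fact n"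
proof -
  have "(\<Sum>k\<in>{n}. real n ^ k /\<^sub>R fact k) \<le> (\<Sum>k. real n ^ k /\<^sub>R fact k)"
    by (rule sum_le_suminf) (use summable_exp_generic[of "real n"] in auto)
  then show ?thesis by (simp add: exp_def field_simps)
qed

text \<open>Logarithms of the counting bound: per element, short intervals cost at most
  \<open>d * log 2 n\<close>, passing from \<open>fact n\<close> to \<open>n ^ n\<close> costs
  \<open>log 2 (exp 1)\<close>, and the colours cost \<open>log 2 (m + 1)\<close>.\<close>

lemma log_num_linear_extensions_interval_order_ge:
  assumes "m > 0" "n > 0" "real (card {j \<in> {..<n}. \<omega> j \<in> short_pairs (1 / real m)}) \<le> d * n"
  shows "real n * ((1 - d) * log 2 n - log 2 (exp 1) - log 2 (m + 1))
    \<le> log 2 (num_linear_extensions {..<n} (interval_order n \<omega>))"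
proof -
  define b where "b = card {j \<in> {..<n}. \<omega> j \<in> short_pairs (1 / real m)}"
  define e where "e = num_linear_extensions {..<n} (interval_order n \<omega>)"
  have F: "fact n \<le> e * (m + 1) ^ n * n ^ b"
    using fact_le_num_linear_extensions_interval_order[OF assms(1)] by (simp add: e_def b_def)
  \<comment> \<open>The counting bound itself shows that a linear extension exists, since
    \<open>fact n\<close> is positive.\<close>
  have "e > 0"
  proof (rule ccontr)
    assume "\<not> e > 0"
    with F show False by simp
  qed
  have "real n ^ n \<le> exp n * fact n" by (rule power_le_exp_fact)
  also have "\<dots> \<le> exp n * (e * (m + 1) ^ n * n ^ b)"
    using F by (metis (mono_tags) exp_ge_zero mult_left_mono of_nat_fact of_nat_le_iff)
  finally have "log 2 (real n ^ n) \<le> log 2 (exp 1 ^ n * (e * (real m + 1) ^ n * real n ^ b))"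
    using assms \<open>e > 0\<close> by (subst log_le_cancel_iff) (auto simp: exp_of_nat_mult[symmetric] add.commute)
  also have "\<dots> = n * log 2 (exp 1) + log 2 e + n * log 2 (real m + 1) + b * log 2 n"
    using assms \<open>e > 0\<close> by (simp add: log_mult log_nat_power)
  also have "b * log 2 n \<le> d * n * log 2 n"
    using assms by (intro mult_right_mono) (auto simp: b_def)
  finally show ?thesis
    using assms by (simp add: log_nat_power e_def algebra_simps)
qed


section \<open>Probability of short intervals, and measurability\<close>

abbreviation unit_uniform :: "real measure" where
  "unit_uniform \<equiv> uniform_measure lborel {0..1}"

lemma prob_space_unit_uniform: "prob_space unit_uniform"
  by (rule prob_space_uniform_measure) auto

lemma sets_short_pairs [measurable]: "short_pairs d \<in> sets (borel \<Otimes>\<^sub>M borel)"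
proof -
  have "Measurable.pred (borel \<Otimes>\<^sub>M borel) (\<lambda>p :: real \<times> real.
      \<not> (0 \<le> min (fst p) (snd p) \<and> max (fst p) (snd p) \<le> 1 \<and> d \<le> \<bar>fst p - snd p\<bar>))"
    by measurable
  then show ?thesis by (simp add: short_pairs_def pred_def space_pair_measure)
qed

lemma sets_unit_square: "sets (unit_uniform \<Otimes>\<^sub>M unit_uniform) = sets (borel \<Otimes>\<^sub>M borel)"
  by (rule sets_pair_measure_cong) auto

text \<open>For \<open>x\<close> in the unit interval, a \<open>y\<close> in the unit interval makes
  a short pair only within distance \<open>d\<close> of \<open>x\<close>, a set of length at most
  \<open>2 * d\<close>; this is integrated over \<open>x\<close>. Any other \<open>x\<close> makes
  every pair short, but such \<open>x\<close> form a null set.\<close>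

lemma measure_short_pairs_le:
  assumes "0 \<le> d"
  shows "measure (unit_uniform \<Otimes>\<^sub>M unit_uniform) (short_pairs d) \<le> 2 * d"
proof -
  interpret U: prob_space unit_uniform by (rule prob_space_unit_uniform)
  interpret UU: pair_prob_space unit_uniform unit_uniform ..
  have "AE x in unit_uniform. x \<in> {0..1}"
    by (rule AE_uniform_measureI) auto
  then have le: "AE x in unit_uniform. emeasure unit_uniform (Pair x -` short_pairs d) \<le> ennreal (2 * d)"
  proof eventually_elim
    case (elim x)
    have [measurable]: "Pair x -` short_pairs d \<in> sets borel"
      by (rule sets_Pair1[OF sets_short_pairs])
    have "emeasure unit_uniform (Pair x -` short_pairs d) = emeasure lborel ({0..1} \<inter> Pair x -` short_pairs d)"
      by (subst emeasure_uniform_measure) (auto simp: divide_ennreal_def)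
    also have "\<dots> \<le> emeasure lborel {x - d..x + d}"
      using elim by (intro emeasure_mono) (auto simp: short_pairs_def abs_if split: if_splits)
    also have "\<dots> = ennreal (2 * d)" using assms by (simp add: algebra_simps)
    finally show ?case .
  qed
  have "emeasure (unit_uniform \<Otimes>\<^sub>M unit_uniform) (short_pairs d)
      = (\<integral>\<^sup>+x. emeasure unit_uniform (Pair x -` short_pairs d) \<partial>unit_uniform)"
    by (rule U.emeasure_pair_measure_alt) (simp add: sets_unit_square)
  also have "\<dots> \<le> (\<integral>\<^sup>+x. ennreal (2 * d) \<partial>unit_uniform)"
    by (rule nn_integral_mono_AE[OF le])
  also have "\<dots> = ennreal (2 * d)" using U.emeasure_space_1 by simp
  finally show ?thesis
    using assms by (simp add: UU.P.emeasure_eq_measure)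
qed

lemma prob_space_random_endpoints: "prob_space (random_endpoints n)"
  unfolding random_endpoints_def
  by (intro prob_space_PiM prob_space_pair prob_space_unit_uniform)

lemma measurable_endpoint [measurable]:
  "j < n \<Longrightarrow> (\<lambda>\<omega>. \<omega> j) \<in> random_endpoints n \<rightarrow>\<^sub>M borel \<Otimes>\<^sub>M borel"
  unfolding random_endpoints_def
  using measurable_component_singleton[of j "{..<n}" "\<lambda>_. unit_uniform \<Otimes>\<^sub>M unit_uniform"]
  by (simp cong: measurable_cong_sets add: sets_unit_square)

lemma prob_endpoint:
  assumes "j < n" "S \<in> sets (borel \<Otimes>\<^sub>M borel)"
  shows "\<P>(\<omega> in random_endpoints n. \<omega> j \<in> S) = measure (unit_uniform \<Otimes>\<^sub>M unit_uniform) S"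
proof -
  interpret UU: prob_space "unit_uniform \<Otimes>\<^sub>M unit_uniform"
    by (intro prob_space_pair prob_space_unit_uniform)
  interpret P: product_prob_space "\<lambda>_. unit_uniform \<Otimes>\<^sub>M unit_uniform" "{..<n}" ..
  show ?thesis
    using P.emeasure_PiM_Collect_single[of j S] assms
    by (simp add: random_endpoints_def measure_def sets_unit_square)
qed

text \<open>The order takes finitely many values, and each value is fixed by finitely many
  comparisons of endpoints. Hence every property \<open>Q\<close> of it is an event, including those
  about \<open>num_linear_extensions\<close>.\<close>

lemma interval_order_event_measurable [measurable]:
  "Measurable.pred (random_endpoints n) (\<lambda>\<omega>. Q (interval_order n \<omega>))"
proof -
  have rel [measurable]: "Measurable.pred (random_endpoints n) (\<lambda>\<omega>. (i, j) \<in> interval_order n \<omega>)" for i j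
  proof (cases "i < n \<and> j < n")
    case True
    then have [measurable]: "(\<lambda>\<omega>. \<omega> i) \<in> random_endpoints n \<rightarrow>\<^sub>M borel \<Otimes>\<^sub>M borel"
      "(\<lambda>\<omega>. \<omega> j) \<in> random_endpoints n \<rightarrow>\<^sub>M borel \<Otimes>\<^sub>M borel" by auto
    show ?thesis using True
      by (simp add: interval_order_def Sup_interval_of Inf_interval_of)
  next
    case False
    then have "(i, j) \<notin> interval_order n \<omega>" for \<omega> by (auto simp: interval_order_def)
    then show ?thesis by simp
  qed
  let ?A = "{..<n} \<times> {..<n}"
  have sub: "interval_order n \<omega> \<subseteq> ?A" for \<omega>
    by (auto simp: interval_order_def)
  have "Q (interval_order n \<omega>) \<longleftrightarrow>
      (\<exists>r \<in> {r \<in> Pow ?A. Q r}. \<forall>x \<in> ?A. x \<in> interval_order n \<omega> \<longleftrightarrow> x \<in> r)" (is "_ \<longleftrightarrow> ?R \<omega>") for \<omega>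
  proof
    assume "Q (interval_order n \<omega>)"
    with sub show "?R \<omega>" by (intro bexI[of _ "interval_order n \<omega>"]) simp_all
  next
    assume "?R \<omega>"
    then obtain r where r: "r \<subseteq> ?A" "Q r" "\<forall>x \<in> ?A. x \<in> interval_order n \<omega> \<longleftrightarrow> x \<in> r" by auto
    with sub have "interval_order n \<omega> = r" by blast
    with r show "Q (interval_order n \<omega>)" by simp
  qed
  moreover have "Measurable.pred (random_endpoints n) ?R"
    using rel by (intro pred_intros_finite) auto
  ultimately show ?thesis by (simp only:)
qed

lemma card_short_pairs_eq_sum:
  fixes n :: nat
  shows "real (card {j \<in> {..<n}. \<omega> j \<in> S}) = (\<Sum>j<n. indicator S (\<omega> j))"
  by (simp add: indicator_def of_bool_def sum.If_cases Int_def)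

text \<open>Markov's inequality for the number of short pairs, whose expectation is at most
  \<open>2 * d * n\<close> by linearity.\<close>

lemma prob_many_short_pairs_le:
  assumes "0 \<le> d" "0 < c" "0 < n"
  shows "\<P>(\<omega> in random_endpoints n. c * n \<le> real (card {j \<in> {..<n}. \<omega> j \<in> short_pairs d})) \<le> 2 * d / c"
proof -
  interpret prob_space "random_endpoints n" by (rule prob_space_random_endpoints)
  let ?I = "\<lambda>j \<omega>. indicator (short_pairs d) (\<omega> j) :: real"
  have I [measurable]: "?I j \<in> borel_measurable (random_endpoints n)" if "j < n" for j
    using that by measurable
  have int: "integrable (random_endpoints n) (?I j)" if "j < n" for j
    using I[OF that] by (rule integrable_const_bound[where B = 1, rotated]) auto
  have "expectation (?I j) \<le> 2 * d" if "j < n" for j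
  proof -
    have "expectation (?I j) = expectation (indicator {\<omega> \<in> space (random_endpoints n). \<omega> j \<in> short_pairs d})"
      by (rule Bochner_Integration.integral_cong) (auto simp: indicator_def)
    also have "\<dots> = \<P>(\<omega> in random_endpoints n. \<omega> j \<in> short_pairs d)"
      by simp (auto intro: arg_cong[where f = prob])
    finally show ?thesis
      using measure_short_pairs_le[OF \<open>0 \<le> d\<close>] prob_endpoint[OF that sets_short_pairs] by simp
  qed
  then have "(\<Sum>j<n. expectation (?I j)) \<le> (\<Sum>j<n. 2 * d)"
    by (intro sum_mono) auto
  then have E: "expectation (\<lambda>\<omega>. \<Sum>j<n. ?I j \<omega>) \<le> 2 * d * n"
    using int by (subst Bochner_Integration.integral_sum) (auto simp: mult.commute)
  have "\<P>(\<omega> in random_endpoints n. c * n \<le> (\<Sum>j<n. ?I j \<omega>)) \<le> expectation (\<lambda>\<omega>. \<Sum>j<n. ?I j \<omega>) / (c * n)"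
    using assms int
    by (intro integral_Markov_inequality_measure[where A = "{}"] Bochner_Integration.integrable_sum)
      (auto intro!: sum_nonneg)
  also have "\<dots> \<le> 2 * d * n / (c * n)"
    using E assms by (intro divide_right_mono) auto
  also have "\<dots> = 2 * d / c" using assms by simp
  finally show ?thesis by (simp only: card_short_pairs_eq_sum)
qed

lemma card_short_pairs_measurable [measurable]:
  "(\<lambda>\<omega>. real (card {j \<in> {..<n}. \<omega> j \<in> short_pairs d})) \<in> borel_measurable (random_endpoints n)"
  unfolding card_short_pairs_eq_sum by measurable

section \<open>Choice of the grid size and passage to the limit\<close>

theorem theorem5p6p7:
  fixes \<epsilon> :: real
  assumes "0 < \<epsilon>" and "\<epsilon> < 1"
  shows "\<exists>\<delta> \<delta>' :: nat \<Rightarrow> real. \<delta> \<in> o(\<lambda>_. 1) \<and> \<delta>' \<in> o(\<lambda>_. 1) \<and>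
    (\<lambda>n. \<P>(\<omega> in random_endpoints n.
        (1 - \<epsilon> + \<delta> n) * real n * log 2 (real n)
          \<le> log 2 (real (num_linear_extensions {..<n} (interval_order n \<omega>))) \<and>
        log 2 (real (num_linear_extensions {..<n} (interval_order n \<omega>)))
          \<le> (1 + \<epsilon> + \<delta>' n) * real n * log 2 (real n))) \<longlonglongrightarrow> 1"
proof (intro exI[of _ "\<lambda>_. 0"] conjI)
  \<comment> \<open>Stated for a relation \<open>r\<close>, so that measurability follows from
    \<open>interval_order_event_measurable\<close>. The summands \<open>+ 0\<close> are the
    instantiated error sequences.\<close>
  define ev where "ev n r \<longleftrightarrow> (1 - \<epsilon> + 0) * real n * log 2 (real n) \<le> log 2 (real (num_linear_extensions {..<n} r)) \<and>
        log 2 (real (num_linear_extensions {..<n} r)) \<le> (1 + \<epsilon> + 0) * real n * log 2 (real n)" for n r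
  \<comment> \<open>It tends to infinity, which makes short intervals rare, yet
    \<open>log 2 (m n + 1)\<close> is negligible against \<open>log 2 n\<close>.\<close>
  define m where "m n = nat \<lceil>ln (real n)\<rceil>" for n
  \<comment> \<open>One half of \<epsilon> pays for the short intervals, the other for the losses
    here; \<open>ln x + 2\<close> bounds \<open>m n + 1\<close> after rounding up.\<close>
  have "eventually (\<lambda>x::real. log 2 (exp 1) + log 2 (ln x + 2) \<le> \<epsilon> / 2 * log 2 x) at_top"
    using assms by real_asymp
  then have ev1: "eventually (\<lambda>n. log 2 (exp 1) + log 2 (ln (real n) + 2) \<le> \<epsilon> / 2 * log 2 (real n)) sequentially"
    using filterlim_real_sequentially by (rule eventually_compose_filterlim)
  have bound: "eventually (\<lambda>n. 1 - 4 / (\<epsilon> * ln (real n)) \<le> \<P>(\<omega> in random_endpoints n. ev n (interval_order n \<omega>))) sequentially"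
    using ev1 eventually_gt_at_top[of 2]
  proof eventually_elim
    case (elim n)
    interpret prob_space "random_endpoints n" by (rule prob_space_random_endpoints)
    have ln: "0 < ln (real n)" using elim by simp
    have m: "m n > 0" "ln (real n) \<le> m n" "m n \<le> ln (real n) + 1"
      using ln unfolding m_def by linarith+
    let ?many = "\<lambda>\<omega>. \<epsilon> / 2 * n \<le> real (card {j \<in> {..<n}. \<omega> j \<in> short_pairs (1 / real (m n))})"
    have "ev n (interval_order n \<omega>)" if "\<not> ?many \<omega>" for \<omega>
    proof -
      let ?e = "log 2 (num_linear_extensions {..<n} (interval_order n \<omega>))"
      have "real n * ((1 - \<epsilon> / 2) * log 2 n - log 2 (exp 1) - log 2 (real (m n) + 1)) \<le> ?e"
        using that m elim by (intro log_num_linear_extensions_interval_order_ge) auto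
      moreover have "log 2 (real (m n) + 1) \<le> log 2 (ln (real n) + 2)"
        using m ln by (subst log_le_cancel_iff) auto
      then have "(1 - \<epsilon>) * log 2 n \<le> (1 - \<epsilon> / 2) * log 2 n - log 2 (exp 1) - log 2 (real (m n) + 1)"
        using elim by (simp add: algebra_simps)
      then have "real n * ((1 - \<epsilon>) * log 2 n) \<le> real n * ((1 - \<epsilon> / 2) * log 2 n - log 2 (exp 1) - log 2 (real (m n) + 1))"
        by (intro mult_left_mono) auto
      moreover have "?e \<le> real n * log 2 n"
        using elim by (intro log_num_linear_extensions_le) auto
      moreover have "0 \<le> \<epsilon> * real n * log 2 n" using assms elim by simp
      ultimately show ?thesis by (auto simp: ev_def distrib_right mult.assoc mult.left_commute)
    qed
    then have "prob {\<omega> \<in> space (random_endpoints n). \<not> ev n (interval_order n \<omega>)}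
        \<le> prob {\<omega> \<in> space (random_endpoints n). ?many \<omega>}"
      by (intro finite_measure_mono) auto
    also have "\<dots> \<le> 2 * (1 / real (m n)) / (\<epsilon> / 2)"
      using assms elim m by (intro prob_many_short_pairs_le) auto
    \<comment> \<open>The left side is \<open>4 / (\<epsilon> * m n)\<close>, and \<open>m n\<close>
      is at least \<open>ln n\<close>.\<close>
    also have "\<dots> \<le> 4 / (\<epsilon> * ln (real n))"
      using assms m ln by (auto simp: field_simps)
    finally show ?case
      using prob_neg[of "\<lambda>\<omega>. ev n (interval_order n \<omega>)"] by simp
  qed
  have "(\<lambda>n. \<P>(\<omega> in random_endpoints n. ev n (interval_order n \<omega>))) \<longlonglongrightarrow> 1"
  proof (rule tendsto_sandwich[OF bound])
    show "eventually (\<lambda>n. \<P>(\<omega> in random_endpoints n. ev n (interval_order n \<omega>)) \<le> 1) sequentially"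
      using prob_space.prob_le_1[OF prob_space_random_endpoints] by (intro always_eventually allI)
    show "(\<lambda>n. 1 - 4 / (\<epsilon> * ln (real n))) \<longlonglongrightarrow> 1" using assms by real_asymp
  qed simp
  then show "(\<lambda>n. \<P>(\<omega> in random_endpoints n.
        (1 - \<epsilon> + 0) * real n * log 2 (real n)
          \<le> log 2 (real (num_linear_extensions {..<n} (interval_order n \<omega>))) \<and>
        log 2 (real (num_linear_extensions {..<n} (interval_order n \<omega>)))
          \<le> (1 + \<epsilon> + 0) * real n * log 2 (real n))) \<longlonglongrightarrow> 1"
    by (simp add: ev_def)
qed auto

end
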